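(* Let $r,s\in\mathbb{N}$ with $r \leq s$, let $j=s-r+1$, and let $l$ be an integer with $0\le l\le r$. If the double star $DS_{r,s}$ admits an exactly $(j+2l)$-unique coloring, then $$\frac{(s+l-1)n}{2} +o(n) \leq \operatorname{ex}_{j+2l}(n, DS_{r,s}) \leq \frac{(r+s+l)n}{2},$$ where $o(n)$ is as $n\to\infty$ with $r,s,l$ fixed.
   Context: Graphs are finite and simple, and all colorings are edge colorings. For $r,s\in\mathbb{N}$, the double star $DS_{r,s}$ is the tree formed by taking a single edge $yx$ and appending $r$ leaves to $y$ and $s$ leaves to $x$. Given a proper edge coloring of a graph $F$ (or of a copy of $F$ inside a properly edge-colored graph), it is exactly $k$-unique if exactly $k$ edges of $F$ have a color that appears exactly once on $F$; it is $k$-unique if at least $k$ edges of $F$ have a color that appears exactly once on $F$. The $k$-unique Turán number $\operatorname{ex}_k(n,F)$ is the largest number of edges in an $n$-vertex graph that has some proper edge coloring containing no $k$-unique copy of $F$ (copies are not necessarily induced subgraphs). *)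

theory Defs
  imports Complex_Main "HOL-Library.Landau_Symbols"
begin

type_synonym 'a graph = "'a set \<times> 'a set set"

abbreviation verts :: "'a graph \<Rightarrow> 'a set" where "verts G \<equiv> fst G"
abbreviation edges :: "'a graph \<Rightarrow> 'a set set" where "edges G \<equiv> snd G"

definition simple_graph :: "'a graph \<Rightarrow> bool" where
  "simple_graph G \<longleftrightarrow> finite (verts G) \<and> (\<forall>e\<in>edges G. e \<subseteq> verts G \<and> card e = 2)"

definition subgraph :: "'a graph \<Rightarrow> 'a graph \<Rightarrow> bool" where
  "subgraph H G \<longleftrightarrow> simple_graph H \<and> simple_graph G \<and> verts H \<subseteq> verts G \<and> edges H \<subseteq> edges G"

definition graph_isomorphic :: "'a graph \<Rightarrow> 'b graph \<Rightarrow> bool" where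
  "graph_isomorphic F H \<longleftrightarrow>
     (\<exists>f. bij_betw f (verts F) (verts H) \<and> edges H = (\<lambda>e. f ` e) ` edges F)"

definition copy_in :: "'a graph \<Rightarrow> 'b graph \<Rightarrow> 'b graph \<Rightarrow> bool" where
  "copy_in F H G \<longleftrightarrow> subgraph H G \<and> graph_isomorphic F H"

definition proper_edge_coloring :: "'a graph \<Rightarrow> ('a set \<Rightarrow> 'c) \<Rightarrow> bool" where
  "proper_edge_coloring G c \<longleftrightarrow>
     (\<forall>e\<in>edges G. \<forall>e'\<in>edges G. e \<noteq> e' \<and> e \<inter> e' \<noteq> {} \<longrightarrow> c e \<noteq> c e')"

definition unique_edges :: "'a graph \<Rightarrow> ('a set \<Rightarrow> 'c) \<Rightarrow> 'a set set" where
  "unique_edges H c = {e \<in> edges H. \<forall>e'\<in>edges H. c e' = c e \<longrightarrow> e' = e}"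

definition exactly_k_unique :: "nat \<Rightarrow> 'a graph \<Rightarrow> ('a set \<Rightarrow> 'c) \<Rightarrow> bool" where
  "exactly_k_unique k H c \<longleftrightarrow> card (unique_edges H c) = k"

definition k_unique :: "nat \<Rightarrow> 'a graph \<Rightarrow> ('a set \<Rightarrow> 'c) \<Rightarrow> bool" where
  "k_unique k H c \<longleftrightarrow> k \<le> card (unique_edges H c)"

text \<open>Up to isomorphism, an \<open>n\<close>-vertex graph may be taken on the vertex set \<open>{..<n}\<close>; since graphs
  are finite, natural numbers suffice as colors.\<close>

definition k_unique_free :: "nat \<Rightarrow> nat \<Rightarrow> 'a graph \<Rightarrow> nat set set \<Rightarrow> bool" where
  "k_unique_free k n F E \<longleftrightarrow> simple_graph ({..<n}, E) \<and>
     (\<exists>c :: nat set \<Rightarrow> nat. proper_edge_coloring ({..<n}, E) c \<and>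
        \<not> (\<exists>H. copy_in F H ({..<n}, E) \<and> k_unique k H c))"

definition ex_k :: "nat \<Rightarrow> nat \<Rightarrow> 'a graph \<Rightarrow> nat" where
  "ex_k k n F = Max {card E | E. k_unique_free k n F E}"

datatype ds_vertex = Y | X | Y_leaf nat | X_leaf nat

definition double_star :: "nat \<Rightarrow> nat \<Rightarrow> ds_vertex graph" where
  "double_star r s =
     ({Y, X} \<union> Y_leaf ` {..<r} \<union> X_leaf ` {..<s},
      {{Y, X}} \<union> (\<lambda>i. {Y, Y_leaf i}) ` {..<r} \<union> (\<lambda>i. {X, X_leaf i}) ` {..<s})"

lemma simple_graph_double_star: "simple_graph (double_star r s)"
  by (auto simp: simple_graph_def double_star_def)

text \<open>The maximum in the definition of \<open>ex_k\<close> is taken over a finite set, which is nonempty as soon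
  as \<open>F\<close> has an edge (the edgeless graph qualifies), so its value is the intended one.\<close>

lemma finite_ex_k: "finite {card E | E. k_unique_free k n F E}"
proof -
  have "{E. k_unique_free k n F E} \<subseteq> Pow (Pow {..<n})"
    by (auto simp: k_unique_free_def simple_graph_def)
  then have "finite {E. k_unique_free k n F E}"
    by (rule finite_subset) simp
  then show ?thesis
    by simp
qed

lemma nonempty_ex_k:
  assumes "edges F \<noteq> {}"
  shows "{card E | E. k_unique_free k n F E} \<noteq> {}"
proof -
  have "k_unique_free k n F {}"
    using assms
    by (auto simp: k_unique_free_def simple_graph_def proper_edge_coloring_def copy_in_def
        subgraph_def graph_isomorphic_def)
  then show ?thesis by blast
qed

end

theory Submission imports Defs
begin

text \<open>
  In a properly colored double star the central edge meets every other edge, so its color is unique,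
  and every other color occurs at most once at \<open>y\<close> and at most once at \<open>x\<close>. If exactly \<open>m\<close> colors
  are repeated, then \<open>r + s + 1 - 2 * m\<close> edges have a unique color. Hence a copy is
  \<open>(j + 2 * l)\<close>-unique iff at most \<open>r - l\<close> colors are repeated.

  Upper bound. A graph of average degree greater than \<open>D = r + s + l\<close> contains an induced subgraph
  whose average degree still exceeds \<open>D\<close> and whose minimum degree exceeds \<open>D / 2\<close>
  (\<open>ex_dense_min_degree\<close>); in it choose \<open>x\<close> of degree more than \<open>D\<close> and any neighbor \<open>y\<close>. As
  \<open>D / 2 \<ge> r\<close>, the vertex \<open>y\<close> has \<open>r\<close> neighbors other than \<open>x\<close>, which become its leaves; at least
  \<open>s + l\<close> neighbors of \<open>x\<close> remain. At most \<open>r\<close> of these are joined to \<open>x\<close> in a color used on the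
  leaves at \<open>y\<close>, so choosing \<open>s\<close> of the remaining neighbors as leaves of \<open>x\<close>, with such colors
  avoided as far as possible, creates at most \<open>r - l\<close> repeated colors (\<open>dense_imp_k_unique_copy\<close>).

  Lower bound. Disjoint copies of the complete bipartite graph \<open>K\<^bsub>d,d\<^esub>\<close> with \<open>d = s + l\<close>, each
  properly colored with the same \<open>d\<close> colors, have \<open>d * n / 2 - O(1)\<close> edges. A double star colored
  with only \<open>d\<close> colors has at most \<open>2 * d - (r + s + 1) < j + 2 * l\<close> edges of unique color
  (\<open>card_unique_edges_few_colors\<close>), so this graph contains no \<open>(j + 2 * l)\<close>-unique copy. The bound
  obtained even has leading coefficient \<open>(s + l) / 2\<close>.
\<close>

section \<open>Double stars\<close>

text \<open>The double star inside a graph that has centers \<open>y\<close> and \<open>x\<close> and leaf sets \<open>A\<close> (at \<open>y\<close>) and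
  \<open>B\<close> (at \<open>x\<close>).\<close>

definition star_pair :: "'a \<Rightarrow> 'a \<Rightarrow> 'a set \<Rightarrow> 'a set \<Rightarrow> 'a graph" where
  "star_pair y x A B =
     ({y, x} \<union> A \<union> B, {{y, x}} \<union> (\<lambda>a. {y, a}) ` A \<union> (\<lambda>b. {x, b}) ` B)"

lemma double_star_iso_star_pair:
  assumes "finite A" "finite B" "y \<noteq> x" "A \<inter> B = {}" "y \<notin> A \<union> B" "x \<notin> A \<union> B"
  shows "graph_isomorphic (double_star (card A) (card B)) (star_pair y x A B)"
proof -
  obtain g where g: "bij_betw g {..<card A} A"
    using ex_bij_betw_nat_finite[OF assms(1)] by (auto simp: atLeast0LessThan)
  obtain h where h: "bij_betw h {..<card B} B"
    using ex_bij_betw_nat_finite[OF assms(2)] by (auto simp: atLeast0LessThan)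
  define f where "f = case_ds_vertex y x g h"
  have f: "f Y = y" "f X = x" "\<And>i. f (Y_leaf i) = g i" "\<And>i. f (X_leaf i) = h i"
    by (auto simp: f_def)
  have gA: "g ` {..<card A} = A" "inj_on g {..<card A}"
    and hB: "h ` {..<card B} = B" "inj_on h {..<card B}"
    using g h by (auto simp: bij_betw_def)
  have gi: "g i \<in> A" if "i < card A" for i using gA that by auto
  have hi: "h i \<in> B" if "i < card B" for i using hB that by auto
  have "inj_on f (verts (double_star (card A) (card B)))"
    using assms gA(2) hB(2)
    by (auto simp: inj_on_def double_star_def f dest: gi hi)
       (metis gi hi disjoint_iff)+
  moreover have "f ` verts (double_star (card A) (card B)) = verts (star_pair y x A B)"
    using gA(1) hB(1)
    by (simp add: double_star_def star_pair_def image_Un f image_image)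
  moreover have "edges (star_pair y x A B) = (\<lambda>e. f ` e) ` edges (double_star (card A) (card B))"
    using image_image[of "\<lambda>a. {y, a}" g "{..<card A}"] image_image[of "\<lambda>b. {x, b}" h "{..<card B}"]
    by (simp add: double_star_def star_pair_def image_Un f image_image gA(1) hB(1))
  ultimately show ?thesis
    unfolding graph_isomorphic_def bij_betw_def by blast
qed

lemma card_edges_star_pair:
  assumes "finite A" "finite B" "y \<noteq> x" "A \<inter> B = {}" "y \<notin> A \<union> B" "x \<notin> A \<union> B"
  shows "card (edges (star_pair y x A B)) = card A + card B + 1"
proof -
  have "card ((\<lambda>a. {y, a}) ` A) = card A" "card ((\<lambda>b. {x, b}) ` B) = card B"
    using assms by (auto intro!: card_image simp: inj_on_def doubleton_eq_iff)
  moreover have "(\<lambda>a. {y, a}) ` A \<inter> (\<lambda>b. {x, b}) ` B = {}"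
    using assms by (auto simp: doubleton_eq_iff)
  moreover have "{y, x} \<notin> (\<lambda>a. {y, a}) ` A \<union> (\<lambda>b. {x, b}) ` B"
    using assms by (auto simp: doubleton_eq_iff)
  ultimately show ?thesis
    using assms(1,2) by (simp add: star_pair_def card_Un_disjoint)
qed

lemma double_star_eq_star_pair:
  "double_star r s = star_pair Y X (Y_leaf ` {..<r}) (X_leaf ` {..<s})"
  by (simp add: double_star_def star_pair_def image_image)

lemma card_edges_double_star: "card (edges (double_star r s)) = r + s + 1"
proof -
  have "card (Y_leaf ` {..<r}) = r" "card (X_leaf ` {..<s}) = s"
    by (simp_all add: card_image inj_on_def)
  then show ?thesis
    unfolding double_star_eq_star_pair by (subst card_edges_star_pair) auto
qed

lemma graph_isomorphic_card_edges:
  assumes "simple_graph F" "graph_isomorphic F H"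
  shows "card (edges H) = card (edges F)"
proof -
  obtain f where f: "bij_betw f (verts F) (verts H)" "edges H = (\<lambda>e. f ` e) ` edges F"
    using assms(2) by (auto simp: graph_isomorphic_def)
  have "inj_on (image f) (Pow (verts F))"
    using f(1) by (auto simp: bij_betw_def intro: inj_on_image_Pow)
  then have "inj_on (image f) (edges F)"
    by (rule inj_on_subset) (use assms(1) in \<open>auto simp: simple_graph_def\<close>)
  then show ?thesis
    by (simp add: f(2) card_image)
qed

lemma double_star_copy_centers:
  assumes "graph_isomorphic (double_star r s) H"
  obtains y x where "\<forall>e\<in>edges H. y \<in> e \<or> x \<in> e"
proof -
  obtain f where "edges H = (\<lambda>e. f ` e) ` edges (double_star r s)"
    using assms by (auto simp: graph_isomorphic_def)
  then have "\<forall>e\<in>edges H. f Y \<in> e \<or> f X \<in> e"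
    by (auto simp: double_star_def)
  then show ?thesis by (rule that)
qed

section \<open>Counting edges of unique color\<close>

text \<open>The coloring is injective on the unique edges together with all edges at \<open>y\<close>, and likewise
  at \<open>x\<close>. These two sets of edges cover \<open>H\<close>, and both contain all unique edges.\<close>

lemma card_unique_edges_few_colors:
  assumes "finite (edges H)" "proper_edge_coloring H c"
    and cover: "\<forall>e\<in>edges H. y \<in> e \<or> x \<in> e"
    and "finite C" "c ` edges H \<subseteq> C"
  shows "card (edges H) + card (unique_edges H c) \<le> 2 * card C"
proof -
  define U where "U = unique_edges H c"
  define D where "D v = {e \<in> edges H. v \<in> e} \<union> U" for v
  have sub: "D v \<subseteq> edges H" for v
    by (auto simp: D_def U_def unique_edges_def)
  have "card (D v) \<le> card C" for v
  proof (rule card_inj_on_le)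
    show "inj_on c (D v)"
    proof (rule inj_onI)
      fix e e' assume e: "e \<in> D v" "e' \<in> D v" "c e = c e'"
      show "e = e'"
      proof (cases "e \<in> U \<or> e' \<in> U")
        case True
        then show ?thesis using e sub[of v] by (auto simp: U_def unique_edges_def)
      next
        case False
        then have "e \<in> edges H" "e' \<in> edges H" "e \<inter> e' \<noteq> {}" using e by (auto simp: D_def)
        then show ?thesis using assms(2) e(3) unfolding proper_edge_coloring_def by metis
      qed
    qed
    show "c ` D v \<subseteq> C" using sub[of v] assms(5) by blast
  qed (use assms in auto)
  from this[of y] this[of x] have "card (D y) + card (D x) \<le> 2 * card C" by simp
  moreover have "card (D y) + card (D x) = card (D y \<union> D x) + card (D y \<inter> D x)"
    using assms(1) sub by (intro card_Un_Int) (auto intro: finite_subset)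
  moreover have "D y \<union> D x = edges H"
    using sub cover by (fastforce simp: D_def)
  moreover have "card U \<le> card (D y \<inter> D x)"
    using assms(1) sub by (intro card_mono) (auto simp: D_def intro: finite_subset)
  ultimately show ?thesis by (simp add: U_def)
qed

text \<open>If \<open>P\<close> is the set of leaves \<open>b\<close> of \<open>x\<close> whose edge repeats a color from \<open>y\<close>, then the edges
  without unique color are those from \<open>x\<close> to \<open>P\<close> and at most \<open>card P\<close> edges at \<open>y\<close>.\<close>

lemma card_unique_edges_star_pair:
  fixes c :: "'a set \<Rightarrow> 'c"
  assumes "finite A" "finite B" "y \<noteq> x" "A \<inter> B = {}" "y \<notin> A \<union> B" "x \<notin> A \<union> B"
    and proper: "proper_edge_coloring (star_pair y x A B) c"
    and few: "card {b \<in> B. c {x, b} \<in> (\<lambda>a. c {y, a}) ` A} \<le> m"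
  shows "card A + card B + 1 \<le> card (unique_edges (star_pair y x A B) c) + 2 * m"
proof -
  define H where "H = star_pair y x A B"
  define P where "P = {b \<in> B. c {x, b} \<in> (\<lambda>a. c {y, a}) ` A}"
  define Q where "Q = {a \<in> A. c {y, a} \<in> (\<lambda>b. c {x, b}) ` P}"
  have fin: "finite P" "finite Q" using assms(1,2) by (auto simp: P_def Q_def)
  have edge: "{y, x} \<in> edges H" "\<And>a. a \<in> A \<Longrightarrow> {y, a} \<in> edges H"
    "\<And>b. b \<in> B \<Longrightarrow> {x, b} \<in> edges H"
    by (auto simp: H_def star_pair_def)
  have ne: "c e \<noteq> c e'" if "e \<in> edges H" "e' \<in> edges H" "e \<noteq> e'" "v \<in> e" "v \<in> e'" for e e' v
    using proper that unfolding H_def proper_edge_coloring_def by blast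
  have "inj_on (\<lambda>a. c {y, a}) Q"
  proof (rule inj_onI)
    fix a a' assume a: "a \<in> Q" "a' \<in> Q" "c {y, a} = c {y, a'}"
    then have "{y, a} = {y, a'}"
      using ne[of "{y, a}" "{y, a'}" y] edge by (auto simp: Q_def)
    then show "a = a'" by (auto simp: doubleton_eq_iff)
  qed
  then have "card Q = card ((\<lambda>a. c {y, a}) ` Q)"
    by (simp add: card_image)
  also have "\<dots> \<le> card ((\<lambda>b. c {x, b}) ` P)"
    using fin by (intro card_mono) (auto simp: Q_def)
  also have "\<dots> \<le> card P"
    using fin by (intro card_image_le)
  finally have QP: "card Q \<le> card P" .
  have "edges H \<subseteq> unique_edges H c \<union> ((\<lambda>b. {x, b}) ` P \<union> (\<lambda>a. {y, a}) ` Q)"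
  proof
    fix e assume e: "e \<in> edges H"
    show "e \<in> unique_edges H c \<union> ((\<lambda>b. {x, b}) ` P \<union> (\<lambda>a. {y, a}) ` Q)"
    proof (cases "e \<in> unique_edges H c")
      case False
      then obtain e' where e': "e' \<in> edges H" "c e' = c e" "e' \<noteq> e"
        using e by (auto simp: unique_edges_def)
      then have disj: "e \<inter> e' = {}" using ne[of e e'] e by (metis disjoint_iff)
      \<comment> \<open>Disjoint edges are leaf edges at different centers.\<close>
      have "(\<exists>a\<in>A. \<exists>b\<in>B. e = {y, a} \<and> e' = {x, b}) \<or> (\<exists>a\<in>A. \<exists>b\<in>B. e' = {y, a} \<and> e = {x, b})"
        using e e'(1) disj by (auto simp: H_def star_pair_def)
      then show ?thesis
      proof (elim disjE bexE conjE)
        fix a b assume ab: "a \<in> A" "b \<in> B" "e = {y, a}" "e' = {x, b}"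
        then have "b \<in> P" using e'(2) by (auto simp: P_def)
        then have "a \<in> Q" using ab e'(2) by (auto simp: Q_def intro!: image_eqI[of _ _ b])
        then show ?thesis using ab by auto
      next
        fix a b assume ab: "a \<in> A" "b \<in> B" "e' = {y, a}" "e = {x, b}"
        then have "b \<in> P" using e'(2) by (auto simp: P_def intro!: image_eqI[of _ _ a])
        then show ?thesis using ab by auto
      qed
    qed simp
  qed
  moreover have finH: "finite (edges H)"
    using assms(1,2) by (simp add: H_def star_pair_def)
  ultimately have "card (edges H)
      \<le> card (unique_edges H c \<union> ((\<lambda>b. {x, b}) ` P \<union> (\<lambda>a. {y, a}) ` Q))"
    using fin by (intro card_mono) (auto simp: unique_edges_def)
  also have "\<dots> \<le> card (unique_edges H c) + (card P + card Q)"
    using fin by (meson add_mono card_Un_le card_image_le le_trans order_refl)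
  also have "\<dots> \<le> card (unique_edges H c) + 2 * m"
    using QP few by (simp add: P_def)
  finally show ?thesis
    using card_edges_star_pair[OF assms(1-6)] by (simp add: H_def)
qed

section \<open>Dense subgraphs of large minimum degree\<close>

lemma handshake:
  assumes "finite V" "finite E" "\<And>e. e \<in> E \<Longrightarrow> e \<subseteq> V \<and> card e = 2"
  shows "(\<Sum>v\<in>V. card {e \<in> E. v \<in> e}) = 2 * card E"
proof -
  have "{v \<in> V. v \<in> e} = e" if "e \<in> E" for e
    using assms(3)[OF that] by blast
  then show ?thesis
    using assms by (intro sum_multicount) auto
qed

text \<open>Deleting a vertex of degree at most \<open>D / 2\<close> does not decrease the excess of
  \<open>2 * card E\<close> over \<open>D * card V\<close>, so a smallest vertex set of positive excess will do.\<close>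

lemma ex_dense_min_degree:
  fixes V :: "'a set" and D :: nat
  assumes "simple_graph (V, E)" "D * card V < 2 * card E"
  obtains W where "W \<subseteq> V" "D * card W < 2 * card {e \<in> E. e \<subseteq> W}"
    "\<forall>v\<in>W. D < 2 * card {e \<in> E. e \<subseteq> W \<and> v \<in> e}"
proof -
  define dense where "dense W \<longleftrightarrow> W \<subseteq> V \<and> D * card W < 2 * card {e \<in> E. e \<subseteq> W}" for W
  have E: "finite V" "\<And>e. e \<in> E \<Longrightarrow> e \<subseteq> V"
    using assms(1) by (auto simp: simple_graph_def)
  then have "finite E" by (meson PowI finite_Pow_iff finite_subset subsetI)
  have "{e \<in> E. e \<subseteq> V} = E" using E by blast
  then have "dense V" using assms(2) by (simp add: dense_def)
  then obtain W where W: "dense W" "\<And>W'. dense W' \<Longrightarrow> card W \<le> card W'"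
    using ex_has_least_nat[of dense V card] by blast
  have "D < 2 * card {e \<in> E. e \<subseteq> W \<and> v \<in> e}" if v: "v \<in> W" for v
  proof (rule ccontr)
    assume low: "\<not> ?thesis"
    have "finite W" using W(1) E(1) by (auto simp: dense_def intro: finite_subset)
    then have cW: "card W = Suc (card (W - {v}))" using v by (metis card_Suc_Diff1)
    have part: "{e \<in> E. e \<subseteq> W} = {e \<in> E. e \<subseteq> W - {v}} \<union> {e \<in> E. e \<subseteq> W \<and> v \<in> e}" by blast
    have "card {e \<in> E. e \<subseteq> W}
        \<le> card {e \<in> E. e \<subseteq> W - {v}} + card {e \<in> E. e \<subseteq> W \<and> v \<in> e}"
      by (subst part) (rule card_Un_le)
    then have "D * card (W - {v}) < 2 * card {e \<in> E. e \<subseteq> W - {v}}"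
      using W(1) low cW by (auto simp: dense_def)
    then have "dense (W - {v})" using W(1) by (auto simp: dense_def)
    from W(2)[OF this] cW show False by simp
  qed
  then show thesis using W(1) that[of W] by (auto simp: dense_def)
qed

lemma card_neighbors:
  assumes "\<And>e. e \<in> E \<Longrightarrow> card e = 2"
  shows "card {u. {v, u} \<in> E} = card {e \<in> E. v \<in> e}"
proof (rule bij_betw_same_card[where f = "\<lambda>u. {v, u}"])
  have "e \<in> (\<lambda>u. {v, u}) ` {u. {v, u} \<in> E}" if "e \<in> E" "v \<in> e" for e
    using assms[OF that(1)] that by (auto simp: card_2_iff insert_commute)
  then show "bij_betw (\<lambda>u. {v, u}) {u. {v, u} \<in> E} {e \<in> E. v \<in> e}"
    by (auto simp: bij_betw_def inj_on_def doubleton_eq_iff)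
qed

section \<open>The upper bound\<close>

text \<open>Elements of \<open>P\<close> are avoided as far as possible when \<open>s\<close> elements of \<open>S\<close> are chosen.\<close>

lemma ex_subset_few_bad:
  assumes "finite S" "s + l \<le> card S" "card (S \<inter> P) \<le> r" "l \<le> r"
  obtains B where "B \<subseteq> S" "card B = s" "card (B \<inter> P) \<le> r - l"
proof (cases "s \<le> card (S - P)")
  case True
  then obtain B where "B \<subseteq> S - P" "card B = s"
    by (metis obtain_subset_with_card_n)
  moreover from this have "B \<inter> P = {}" by blast
  ultimately show ?thesis using that[of B] by auto
next
  case False
  have split: "card S = card (S - P) + card (S \<inter> P)"
    using assms(1) by (metis Int_commute add.commute card_Diff_subset_Int card_mono finite_Int
        inf_le1 le_add_diff_inverse)
  then have "s - card (S - P) \<le> card (S \<inter> P)" using assms by simp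
  then obtain T where T: "T \<subseteq> S \<inter> P" "card T = s - card (S - P)"
    by (metis obtain_subset_with_card_n)
  have "card ((S - P) \<union> T) = s"
    using T False assms(1) by (subst card_Un_disjoint) (auto intro: finite_subset)
  moreover have "((S - P) \<union> T) \<inter> P = T" using T by blast
  ultimately show ?thesis
    using T split assms that[of "(S - P) \<union> T"] by auto
qed

lemma dense_imp_k_unique_copy:
  fixes V :: "'a set" and c :: "'a set \<Rightarrow> 'c"
  assumes G: "simple_graph (V, E)" and c: "proper_edge_coloring (V, E) c"
    and rs: "r \<le> s" "l \<le> r" and dense: "(r + s + l) * card V < 2 * card E"
  shows "\<exists>H. copy_in (double_star r s) H (V, E) \<and> k_unique (s - r + 1 + 2 * l) H c"
proof -
  obtain W where W: "W \<subseteq> V" "(r + s + l) * card W < 2 * card {e \<in> E. e \<subseteq> W}"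
    and min_deg: "\<forall>v\<in>W. r + s + l < 2 * card {e \<in> E. e \<subseteq> W \<and> v \<in> e}"
    using ex_dense_min_degree[OF G dense] by blast
  define F where "F = {e \<in> E. e \<subseteq> W}"
  define N where "N v = {u. {v, u} \<in> F}" for v
  have E2: "\<And>e. e \<in> E \<Longrightarrow> card e = 2" "\<And>e. e \<in> E \<Longrightarrow> e \<subseteq> V"
    using G by (auto simp: simple_graph_def)
  have finW: "finite W" using G W(1) by (auto simp: simple_graph_def intro: finite_subset)
  then have finF: "finite F" by (auto simp: F_def intro: finite_subset[of _ "Pow W"])
  have cardN: "card (N v) = card {e \<in> F. v \<in> e}" for v
    unfolding N_def by (rule card_neighbors) (auto simp: F_def E2)
  have NW: "N v \<subseteq> W" for v by (auto simp: N_def F_def)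
  have finN: "finite (N v)" for v using NW finW by (rule finite_subset)
  have irrefl: "v \<notin> N v" for v using E2(1)[of "{v}"] by (auto simp: N_def F_def)
  obtain x where x: "x \<in> W" "r + s + l < card (N x)"
  proof (rule ccontr)
    assume "\<not> thesis"
    then have "card {e \<in> F. v \<in> e} \<le> r + s + l" if "v \<in> W" for v
      using that \<open>\<And>x. x \<in> W \<Longrightarrow> r + s + l < card (N x) \<Longrightarrow> thesis\<close> by (force simp: cardN)
    then have "(\<Sum>v\<in>W. card {e \<in> F. v \<in> e}) \<le> card W * (r + s + l)"
      using sum_bounded_above[of W _ "r + s + l"] by simp
    moreover have "(\<Sum>v\<in>W. card {e \<in> F. v \<in> e}) = 2 * card F"
      using finW finF by (rule handshake) (auto simp: F_def E2)
    ultimately show False using W(2) by (simp add: F_def mult.commute)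
  qed
  obtain y where y: "y \<in> N x"
    using x(2) by (metis card.empty ex_in_conv not_less_zero)
  have xy: "x \<noteq> y" using y irrefl by blast
  have "r + s + l < 2 * card (N y)"
    using min_deg y NW by (auto simp: cardN F_def)
  moreover have "x \<in> N y" using y by (simp add: N_def insert_commute)
  ultimately have "r \<le> card (N y - {x})"
    using rs finN by simp
  then obtain A where A: "A \<subseteq> N y - {x}" "card A = r"
    by (metis obtain_subset_with_card_n)
  have finA: "finite A" using A(1) finN by (meson finite_Diff finite_subset)
  have yA: "y \<notin> A" using A irrefl by blast
  define S where "S = N x - {y} - A"
  define P where "P = {b. c {x, b} \<in> (\<lambda>a. c {y, a}) ` A}"
  have "card (N x - {y}) - card A \<le> card S"
    unfolding S_def using finA by (rule diff_card_le_card_Diff)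
  then have cS: "s + l \<le> card S" using x(2) y A(2) finN by simp
  have "inj_on (\<lambda>b. c {x, b}) (S \<inter> P)"
  proof (rule inj_onI)
    fix b b' assume b: "b \<in> S \<inter> P" "b' \<in> S \<inter> P" "c {x, b} = c {x, b'}"
    then have "{x, b} \<in> E" "{x, b'} \<in> E" by (auto simp: S_def N_def F_def)
    then have "{x, b} = {x, b'}"
      using c b(3) unfolding proper_edge_coloring_def by (metis disjoint_iff insertI1 snd_conv)
    then show "b = b'" by (auto simp: doubleton_eq_iff)
  qed
  then have "card (S \<inter> P) \<le> card ((\<lambda>a. c {y, a}) ` A)"
    using finA by (intro card_inj_on_le[where f = "\<lambda>b. c {x, b}"]) (auto simp: P_def)
  also have "\<dots> \<le> r" using finA A(2) card_image_le by blast
  finally have few: "card (S \<inter> P) \<le> r" .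
  have "finite S" using finN by (simp add: S_def)
  from ex_subset_few_bad[OF this cS few rs(2)]
  obtain B where B: "B \<subseteq> S" "card B = s" "card (B \<inter> P) \<le> r - l"
    by blast
  have finB: "finite B" using B(1) finN by (auto simp: S_def intro: finite_subset)
  have conds: "finite A" "finite B" "y \<noteq> x" "A \<inter> B = {}" "y \<notin> A \<union> B" "x \<notin> A \<union> B"
    using finA finB xy yA A(1) B(1) irrefl by (auto simp: S_def)
  define H where "H = star_pair y x A B"
  have HE: "edges H \<subseteq> E" "verts H \<subseteq> V"
    using A(1) B(1) y x(1) NW W(1)
    by (auto simp: H_def star_pair_def S_def N_def F_def insert_commute)
  have "finite (verts H)" "\<And>e. e \<in> edges H \<Longrightarrow> e \<subseteq> verts H"
    using finA finB by (auto simp: H_def star_pair_def)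
  then have "simple_graph H"
    using E2(1) HE(1) unfolding simple_graph_def by blast
  then have "copy_in (double_star r s) H (V, E)"
    using double_star_iso_star_pair[OF conds] HE G A(2) B(2)
    by (auto simp: copy_in_def subgraph_def H_def)
  moreover have "proper_edge_coloring H c"
    using c HE(1) unfolding proper_edge_coloring_def by (simp add: subset_iff)
  then have "card A + card B + 1 \<le> card (unique_edges H c) + 2 * (r - l)"
    using card_unique_edges_star_pair[OF conds, of c "r - l"] B(3)
    by (simp add: H_def P_def Int_def)
  then have "k_unique (s - r + 1 + 2 * l) H c"
    using A(2) B(2) rs by (simp add: k_unique_def)
  ultimately show ?thesis by blast
qed

lemma ex_k_double_star_upper:
  assumes "r \<le> s" "l \<le> r"
  shows "2 * ex_k (s - r + 1 + 2 * l) n (double_star r s) \<le> (r + s + l) * n"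
proof -
  let ?M = "{card E | E. k_unique_free (s - r + 1 + 2 * l) n (double_star r s) E}"
  have "edges (double_star r s) \<noteq> {}" by (simp add: double_star_def)
  then have "Max ?M \<in> ?M"
    by (intro Max_in finite_ex_k nonempty_ex_k)
  then obtain E where E: "k_unique_free (s - r + 1 + 2 * l) n (double_star r s) E"
    and ex: "ex_k (s - r + 1 + 2 * l) n (double_star r s) = card E"
    by (auto simp: ex_k_def)
  have "\<not> (r + s + l) * card {..<n} < 2 * card E"
    using E dense_imp_k_unique_copy[OF _ _ assms, of "{..<n}" E]
    unfolding k_unique_free_def by blast
  then show ?thesis by (simp only: ex card_lessThan not_less)
qed

section \<open>The lower bound\<close>

text \<open>The edge joining the \<open>i\<close>-th vertex of the first part to the \<open>k\<close>-th vertex of the second part in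
  the \<open>q\<close>-th copy of the complete bipartite graph \<open>K\<^bsub>d,d\<^esub>\<close>, where the copies occupy consecutive
  blocks of \<open>2 * d\<close> natural numbers.\<close>

definition block_edge :: "nat \<Rightarrow> nat \<times> nat \<times> nat \<Rightarrow> nat set" where
  "block_edge d = (\<lambda>(q, i, k). {2 * d * q + i, 2 * d * q + d + k})"

text \<open>The edges of as many such copies as fit into \<open>{..<n}\<close>; the remaining vertices
  are isolated. For \<open>d = 0\<close> there are no edges.\<close>

definition bipartite_blocks :: "nat \<Rightarrow> nat \<Rightarrow> nat set set" where
  "bipartite_blocks d n = block_edge d ` ({..<n div (2 * d)} \<times> {..<d} \<times> {..<d})"

lemma block_vertex_eq:
  fixes d q q' i i' :: nat
  assumes "2 * d * q + i = 2 * d * q' + i'" "i < 2 * d" "i' < 2 * d"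
  shows "q = q' \<and> i = i'"
proof -
  have "(i + 2 * d * q) div (2 * d) = q" "(i' + 2 * d * q') div (2 * d) = q'"
    using assms(2,3) by (subst div_mult_self2; simp)+
  with assms(1) show ?thesis by (simp add: add.commute)
qed

lemma block_edge_intersect:
  assumes "i < d" "k < d" "i' < d" "k' < d"
    and "block_edge d (q, i, k) \<inter> block_edge d (q', i', k') \<noteq> {}"
  shows "q = q' \<and> (i = i' \<or> k = k')"
proof -
  have "\<exists>u\<in>{i, d + k}. \<exists>u'\<in>{i', d + k'}. 2 * d * q + u = 2 * d * q' + u'"
    using assms(5) by (auto simp: block_edge_def add.assoc)
  then obtain u u' where u: "u \<in> {i, d + k}" "u' \<in> {i', d + k'}"
    "2 * d * q + u = 2 * d * q' + u'" by blast
  have "u < 2 * d" "u' < 2 * d" using u assms(1-4) by auto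
  from block_vertex_eq[OF u(3) this] show ?thesis using u(1,2) assms(1-4) by auto
qed

text \<open>Modulo \<open>d\<close>, the sum of the two ends of a block edge is \<open>i + k\<close>: the sum modulo \<open>d\<close> colors
  each block by the addition table of the integers modulo \<open>d\<close>.\<close>

lemma sum_block_edge:
  assumes "i < d" "k < d"
  shows "\<Sum>(block_edge d (q, i, k)) mod d = (i + k) mod d"
proof -
  have "\<Sum>(block_edge d (q, i, k)) = i + k + d * (4 * q + 1)"
    using assms by (simp add: block_edge_def algebra_simps)
  then show ?thesis by (metis mod_mult_self2)
qed

lemma mod_add_left_cancel_less:
  fixes i k k' d :: nat
  assumes "(i + k) mod d = (i + k') mod d" "k < d" "k' < d"
  shows "k = k'"
proof -
  \<comment> \<open>Adding \<open>d * i - i\<close> turns \<open>i\<close> into a multiple of \<open>d\<close>.\<close>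
  have "(i + k + (d * i - i)) mod d = (i + k' + (d * i - i)) mod d"
    using assms(1) by (metis mod_add_left_eq)
  moreover have "i \<le> d * i" using assms(2) by simp
  then have "i + k + (d * i - i) = k + d * i" "i + k' + (d * i - i) = k' + d * i" by simp_all
  ultimately show ?thesis using assms(2,3) by simp
qed

lemma block_edge_same_color:
  assumes "i < d" "k < d" "i' < d" "k' < d"
    and "block_edge d (q, i, k) \<inter> block_edge d (q', i', k') \<noteq> {}"
    and "\<Sum>(block_edge d (q, i, k)) mod d = \<Sum>(block_edge d (q', i', k')) mod d"
  shows "(q, i, k) = (q', i', k')"
proof -
  have "(i + k) mod d = (i' + k') mod d" using assms(1-4,6) by (simp add: sum_block_edge)
  then show ?thesis
    using block_edge_intersect[OF assms(1-5)] assms(1-4)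
      mod_add_left_cancel_less[of i k d k'] mod_add_left_cancel_less[of k i d i']
    by (metis add.commute)
qed

lemma proper_bipartite_blocks:
  "proper_edge_coloring (V, bipartite_blocks d n) (\<lambda>e. \<Sum>e mod d)"
proof -
  have "e = e'" if e: "e \<in> bipartite_blocks d n" "e' \<in> bipartite_blocks d n"
    and meet: "e \<inter> e' \<noteq> {}" and same: "\<Sum>e mod d = \<Sum>e' mod d" for e e'
  proof -
    obtain q i k q' i' k' where lt: "i < d" "k < d" "i' < d" "k' < d"
      and ee: "e = block_edge d (q, i, k)" "e' = block_edge d (q', i', k')"
      using e by (auto simp: bipartite_blocks_def)
    show ?thesis
      unfolding ee block_edge_same_color[OF lt meet[unfolded ee] same[unfolded ee]] ..
  qed
  then show ?thesis unfolding proper_edge_coloring_def by auto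
qed

lemma card_bipartite_blocks: "card (bipartite_blocks d n) = n div (2 * d) * d\<^sup>2"
proof -
  have "inj_on (block_edge d) ({..<n div (2 * d)} \<times> {..<d} \<times> {..<d})"
  proof (rule inj_onI)
    fix p p' assume p: "p \<in> {..<n div (2 * d)} \<times> {..<d} \<times> {..<d}"
      "p' \<in> {..<n div (2 * d)} \<times> {..<d} \<times> {..<d}" "block_edge d p = block_edge d p'"
    obtain q i k q' i' k' where "p = (q, i, k)" "p' = (q', i', k')" by (metis prod_cases3)
    moreover have "block_edge d p \<noteq> {}" by (simp add: block_edge_def split: prod.splits)
    ultimately show "p = p'"
      using p block_edge_same_color[of i d k i' k' q q'] by auto
  qed
  then show ?thesis
    by (simp add: bipartite_blocks_def card_image card_cartesian_product power2_eq_square)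
qed

lemma simple_bipartite_blocks: "simple_graph ({..<n}, bipartite_blocks d n)"
proof -
  have "block_edge d (q, i, k) \<subseteq> {..<n} \<and> card (block_edge d (q, i, k)) = 2"
    if "q < n div (2 * d)" "i < d" "k < d" for q i k
  proof -
    have "2 * d * Suc q \<le> 2 * d * (n div (2 * d))"
      using that(1) by (intro mult_le_mono2) simp
    also have "\<dots> \<le> n" by simp
    finally show ?thesis using that(2,3) by (auto simp: block_edge_def)
  qed
  then show ?thesis by (auto simp: simple_graph_def bipartite_blocks_def)
qed

lemma ex_k_double_star_lower:
  assumes "r \<le> s"
  shows "n div (2 * (s + l)) * (s + l)\<^sup>2 \<le> ex_k (s - r + 1 + 2 * l) n (double_star r s)"
proof -
  define d where "d = s + l"
  define E where "E = bipartite_blocks d n"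
  define c where "c e = \<Sum>e mod d" for e :: "nat set"
  have proper: "proper_edge_coloring ({..<n}, E) c"
    using proper_bipartite_blocks by (simp add: E_def c_def[abs_def])
  have "\<not> k_unique (s - r + 1 + 2 * l) H c" if H: "copy_in (double_star r s) H ({..<n}, E)" for H
  proof -
    have sub: "edges H \<subseteq> E" and iso: "graph_isomorphic (double_star r s) H"
      using H by (auto simp: copy_in_def subgraph_def)
    obtain y x where cover: "\<forall>e\<in>edges H. y \<in> e \<or> x \<in> e"
      using double_star_copy_centers[OF iso] by blast
    have "finite (edges H)" using sub by (rule finite_subset) (simp add: E_def bipartite_blocks_def)
    moreover have "proper_edge_coloring H c"
      using proper sub unfolding proper_edge_coloring_def by (simp add: subset_iff)
    moreover have "c ` edges H \<subseteq> {..<d}"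
    proof -
      \<comment> \<open>For \<open>d = 0\<close> there are no edges.\<close>
      have "0 < d" if "e \<in> E" for e using that by (auto simp: E_def bipartite_blocks_def)
      then show ?thesis using sub by (auto simp: c_def)
    qed
    ultimately have "card (edges H) + card (unique_edges H c) \<le> 2 * d"
      using card_unique_edges_few_colors[OF _ _ cover, of c "{..<d}"] by simp
    moreover have "card (edges H) = r + s + 1"
      using graph_isomorphic_card_edges[OF simple_graph_double_star iso]
      by (simp add: card_edges_double_star)
    ultimately show ?thesis using assms by (simp add: k_unique_def d_def)
  qed
  then have "k_unique_free (s - r + 1 + 2 * l) n (double_star r s) E"
    using proper simple_bipartite_blocks unfolding k_unique_free_def E_def by blast
  then have "card E \<le> ex_k (s - r + 1 + 2 * l) n (double_star r s)"
    unfolding ex_k_def by (intro Max_ge finite_ex_k) blast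
  then show ?thesis by (simp add: E_def d_def card_bipartite_blocks)
qed

section \<open>The extremal number of double stars\<close>

theorem theorem4p5:
  fixes r s j l :: nat
  assumes "r \<le> s"
    and "j = s - r + 1"
    and "l \<le> r"
    and "\<exists>c :: ds_vertex set \<Rightarrow> nat. proper_edge_coloring (double_star r s) c \<and>
           exactly_k_unique (j + 2 * l) (double_star r s) c"
  shows "(\<exists>f :: nat \<Rightarrow> real. f \<in> o(\<lambda>n. real n) \<and>
            (\<forall>n. (real s + real l - 1) * real n / 2 + f n
                   \<le> real (ex_k (j + 2 * l) n (double_star r s)))) \<and>
         (\<forall>n. real (ex_k (j + 2 * l) n (double_star r s))
                \<le> (real r + real s + real l) * real n / 2)"
proof (intro conjI exI allI)
  define d where "d = s + l"
  show "(\<lambda>n. - (real d)\<^sup>2) \<in> o(\<lambda>n. real n)"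
  proof (rule smalloI_tendsto)
    show "(\<lambda>n. - (real d)\<^sup>2 / real n) \<longlonglongrightarrow> 0"
      by (rule lim_const_over_n)
    show "eventually (\<lambda>n. real n \<noteq> 0) sequentially"
      using eventually_gt_at_top[of "0::nat"] by eventually_elim simp
  qed
  fix n
  have "real n * real d \<le> 2 * real (n div (2 * d) * d\<^sup>2) + 2 * (real d)\<^sup>2"
  proof -
    have "n * d \<le> 2 * (n div (2 * d) * d\<^sup>2) + 2 * d\<^sup>2"
    proof (cases "d = 0")
      case False
      have "n = n div (2 * d) * (2 * d) + n mod (2 * d)"
        by (rule div_mult_mod_eq[symmetric])
      also have "\<dots> \<le> n div (2 * d) * (2 * d) + 2 * d"
        using False by (simp add: less_imp_le)
      finally have "n * d \<le> (n div (2 * d) * (2 * d) + 2 * d) * d" by (rule mult_le_mono1)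
      then show ?thesis by (simp add: power2_eq_square algebra_simps)
    qed simp
    then have "real (n * d) \<le> real (2 * (n div (2 * d) * d\<^sup>2) + 2 * d\<^sup>2)"
      by (rule of_nat_mono)
    then show ?thesis by simp
  qed
  moreover have "real (n div (2 * d) * d\<^sup>2) \<le> real (ex_k (j + 2 * l) n (double_star r s))"
    using ex_k_double_star_lower[OF assms(1), of n l] assms(2) by (simp add: d_def del: of_nat_mult)
  ultimately show "(real s + real l - 1) * real n / 2 + - (real d)\<^sup>2
      \<le> real (ex_k (j + 2 * l) n (double_star r s))"
    by (simp add: d_def algebra_simps)
next
  fix n
  have "real (2 * ex_k (j + 2 * l) n (double_star r s)) \<le> real ((r + s + l) * n)"
    using ex_k_double_star_upper[OF assms(1,3), of n] assms(2) by (intro of_nat_mono) simp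
  then show "real (ex_k (j + 2 * l) n (double_star r s))
      \<le> (real r + real s + real l) * real n / 2"
    by simp
qed

end
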